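(* Let $g : \omega \to \omega$ be a left-c.e. increasing function. For every $n \geq 1$, there is a $\Delta^0_2$ coloring $f : [\omega]^n \to d_n$ such that every infinite $f$-thin set computes a function dominating $g$.
   Context: A function $g : \omega \to \omega$ is left-c.e. if there is a uniformly computable sequence of functions $g_0, g_1, \dots$ such that for every $x$, $g_0(x), g_1(x), \dots$ is a non-decreasing sequence converging to $g(x)$. $[\omega]^n$ is the set of $n$-element subsets of $\omega$. Given $f : [\omega]^n \to k$, a set $H$ is $f$-thin if $|f[H]^n| \leq k-1$. A function $h$ dominates $g$ if $h(x)\ge g(x)$ for all $x$. The Catalan numbers are defined by $d_0 = 1$ and $d_{m+1} = \sum_{i=0}^m d_i d_{m-i}$. *)

theory Defs
  imports Complex_Main "HOL-Library.Ramsey" "HOL-Library.FuncSet"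
begin

section \<open>Computability relative to a set\<close>

text \<open>Programs for the partial functions on tuples of natural numbers that are recursive in an
  oracle set. Arities are not part of the syntax; a tuple is a list.\<close>

datatype prog =
    Zero
  | Succ
  | Proj nat
  | Oracle
  | Comp prog "prog list"
  | PrimRec prog prog
  | Mu prog

text \<open>\<open>eval A p xs y\<close>: the program \<open>p\<close> with oracle \<open>A\<close> halts on input \<open>xs\<close> with output \<open>y\<close>.
  The recursion variable and the search variable are the head of the argument list. The unbounded
  search requires convergence, to a nonzero value, at all smaller arguments.\<close>

inductive eval :: "nat set \<Rightarrow> prog \<Rightarrow> nat list \<Rightarrow> nat \<Rightarrow> bool" for A :: "nat set" where
  eval_Zero: "eval A Zero xs 0"
| eval_Succ: "eval A Succ [x] (Suc x)"
| eval_Proj: "i < length xs \<Longrightarrow> eval A (Proj i) xs (xs ! i)"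
| eval_Oracle: "eval A Oracle [x] (of_bool (x \<in> A))"
| eval_Comp: "list_all2 (\<lambda>p y. eval A p xs y) ps ys \<Longrightarrow> eval A q ys z \<Longrightarrow> eval A (Comp q ps) xs z"
| eval_PrimRec_0: "eval A p xs y \<Longrightarrow> eval A (PrimRec p q) (0 # xs) y"
| eval_PrimRec_Suc: "eval A (PrimRec p q) (m # xs) r \<Longrightarrow> eval A q (m # r # xs) y
    \<Longrightarrow> eval A (PrimRec p q) (Suc m # xs) y"
| eval_Mu: "eval A p (m # xs) 0 \<Longrightarrow> \<forall>i<m. \<exists>y. eval A p (i # xs) (Suc y) \<Longrightarrow> eval A (Mu p) xs m"

lemma eval_deterministic:
  assumes "eval A p xs y" and "eval A p xs z"
  shows "y = z"
  using assms
proof (induction arbitrary: z rule: eval.induct)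
  case (eval_Comp xs ps ys q z')
  from eval_Comp.prems obtain ys' where
    ys': "list_all2 (\<lambda>p y. eval A p xs y) ps ys'" and z: "eval A q ys' z"
    by (cases rule: eval.cases) auto
  have "ys = ys'"
    using eval_Comp.IH(1) ys' by (auto simp: list_all2_conv_all_nth intro!: nth_equalityI)
  with z eval_Comp.IH(2) show ?case by blast
next
  case (eval_Mu p m xs)
  from eval_Mu.prems have z: "eval A p (z # xs) 0" "\<forall>i<z. \<exists>y. eval A p (i # xs) (Suc y)"
    by (cases rule: eval.cases; simp)+
  have "\<not> z < m" using eval_Mu.IH(2) z(1) by fastforce
  moreover have "\<not> m < z" using eval_Mu.IH(1) z(2) by fastforce
  ultimately show ?case by simp
next
  case (eval_PrimRec_0 p xs y q)
  from eval_PrimRec_0.prems show ?case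
    by (cases rule: eval.cases) (auto dest: eval_PrimRec_0.IH)
next
  case (eval_PrimRec_Suc p q m xs r y)
  from eval_PrimRec_Suc.prems obtain r' where
    "eval A (PrimRec p q) (m # xs) r'" "eval A q (m # r' # xs) z"
    by (cases rule: eval.cases) auto
  with eval_PrimRec_Suc.IH show ?case by blast
qed (auto elim: eval.cases)

text \<open>Computability in \<open>A\<close> of a total \<open>k\<close>-ary function; only the values on lists of length \<open>k\<close>
  matter.\<close>

definition computable_in :: "nat set \<Rightarrow> nat \<Rightarrow> (nat list \<Rightarrow> nat) \<Rightarrow> bool" where
  "computable_in A k F \<longleftrightarrow> (\<exists>p. \<forall>xs. length xs = k \<longrightarrow> eval A p xs (F xs))"

definition computes :: "nat set \<Rightarrow> (nat \<Rightarrow> nat) \<Rightarrow> bool" where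
  "computes A h \<longleftrightarrow> computable_in A 1 (\<lambda>xs. h (xs ! 0))"

definition decidable :: "nat \<Rightarrow> (nat list \<Rightarrow> bool) \<Rightarrow> bool" where
  "decidable k R \<longleftrightarrow> computable_in {} k (\<lambda>xs. of_bool (R xs))"


section \<open>The arithmetical hierarchy\<close>

text \<open>\<open>is_Sigma n k R\<close>: the \<open>k\<close>-ary relation \<open>R\<close> is \<open>\<Sigma>\<^sup>0\<^sub>n\<close>, and dually \<open>is_Pi\<close>. At level 0
  these are the decidable relations.\<close>

fun is_Sigma :: "nat \<Rightarrow> nat \<Rightarrow> (nat list \<Rightarrow> bool) \<Rightarrow> bool"
  and is_Pi :: "nat \<Rightarrow> nat \<Rightarrow> (nat list \<Rightarrow> bool) \<Rightarrow> bool"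
where
  "is_Sigma 0 k R \<longleftrightarrow> decidable k R"
| "is_Sigma (Suc n) k R \<longleftrightarrow>
    (\<exists>P. is_Pi n (Suc k) P \<and> (\<forall>xs. length xs = k \<longrightarrow> R xs \<longleftrightarrow> (\<exists>y. P (y # xs))))"
| "is_Pi 0 k R \<longleftrightarrow> decidable k R"
| "is_Pi (Suc n) k R \<longleftrightarrow>
    (\<exists>P. is_Sigma n (Suc k) P \<and> (\<forall>xs. length xs = k \<longrightarrow> R xs \<longleftrightarrow> (\<forall>y. P (y # xs))))"

definition is_Delta :: "nat \<Rightarrow> nat \<Rightarrow> (nat list \<Rightarrow> bool) \<Rightarrow> bool" where
  "is_Delta n k R \<longleftrightarrow> is_Sigma n k R \<and> is_Pi n k R"


section \<open>Colorings, thin sets, domination\<close>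

text \<open>A coloring of \<open>[\<omega>]\<^sup>n\<close> is \<open>\<Delta>\<^sup>0\<^sub>2\<close> if its graph is, where an \<open>n\<close>-element set is presented as
  the strictly increasing list of its elements and the color is put in front of that list.\<close>

definition Delta2_coloring :: "nat \<Rightarrow> (nat set \<Rightarrow> nat) \<Rightarrow> bool" where
  "Delta2_coloring n f \<longleftrightarrow>
    is_Delta 2 (Suc n) (\<lambda>ys. sorted_wrt (<) (tl ys) \<and> f (set (tl ys)) = hd ys)"

definition thin :: "nat \<Rightarrow> nat \<Rightarrow> (nat set \<Rightarrow> nat) \<Rightarrow> nat set \<Rightarrow> bool" where
  "thin n k f H \<longleftrightarrow> card (f ` nsets H n) \<le> k - 1"

definition left_ce :: "(nat \<Rightarrow> nat) \<Rightarrow> bool" where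
  "left_ce g \<longleftrightarrow> (\<exists>G :: nat \<Rightarrow> nat \<Rightarrow> nat.
    computable_in {} 2 (\<lambda>xs. G (xs ! 0) (xs ! 1)) \<and>
    (\<forall>x. incseq (\<lambda>s. G s x) \<and> (\<lambda>s. G s x) \<longlonglongrightarrow> g x))"

definition dominates :: "(nat \<Rightarrow> nat) \<Rightarrow> (nat \<Rightarrow> nat) \<Rightarrow> bool" where
  "dominates h g \<longleftrightarrow> (\<forall>x. g x \<le> h x)"

fun catalan :: "nat \<Rightarrow> nat" where
  "catalan 0 = 1"
| "catalan (Suc m) = (\<Sum>i=0..m. catalan i * catalan (m - i))"

end

theory Submission imports Defs begin

text \<open>Fix the stage approximation \<open>G s\<close> of \<open>g\<close>, and call a pair \<open>x < y\<close> small if \<open>y < g x\<close>, and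
  small by stage \<open>s\<close> if \<open>y < G s x\<close>. An increasing tuple is cut at its large adjacent pairs into
  blocks all of whose adjacent pairs are small. A block \<open>x\<^sub>0, \<dots>\<close> with more than one element is
  described by the first entry, if any, which as a stage reveals that \<open>(x\<^sub>0, x\<^sub>1)\<close> is small: the
  block is \<open>x\<^sub>0\<close> followed by two shorter blocks that overlap in the last entry not revealing this.
  Both decompositions are Catalan recursions, so a tuple has at most one shape in a set of
  \<open>catalan n\<close> binary trees, and its color is that shape.

  Let \<open>H\<close> compute no function dominating \<open>g\<close>. By induction on the tree, each block shape occurs in
  each infinite set decidable in \<open>H\<close>, hence each shape occurs in \<open>H\<close>, and \<open>H\<close> is not thin. If
  smallness of \<open>(x\<^sub>0, x\<^sub>1)\<close> is not to be revealed by \<open>x\<^sub>a\<close>, then \<open>H\<close> searches for a block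
  \<open>x\<^sub>1 < \<dots> < x\<^sub>a\<close> of the given shape with \<open>G x\<^sub>a x\<^sub>0 \<le> x\<^sub>1\<close>: were \<open>g x\<^sub>0 \<le> x\<^sub>1\<close> for
  all those found, they would yield a function dominating \<open>g\<close>.\<close>

section \<open>Closure properties of computability\<close>

abbreviation decidable_in :: "nat set \<Rightarrow> nat \<Rightarrow> (nat list \<Rightarrow> bool) \<Rightarrow> bool" where
  "decidable_in A k R \<equiv> computable_in A k (\<lambda>xs. of_bool (R xs))"

lemma computable_in_cong:
  assumes "computable_in A k F" "\<And>xs. length xs = k \<Longrightarrow> F xs = F' xs"
  shows "computable_in A k F'"
  using assms unfolding computable_in_def by metis

lemma computable_in_proj: "i < k \<Longrightarrow> computable_in A k (\<lambda>xs. xs ! i)"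
  unfolding computable_in_def using eval_Proj by blast

lemma computable_in_comp:
  assumes "computable_in A (length Fs) F" "\<And>E. E \<in> set Fs \<Longrightarrow> computable_in A k E"
  shows "computable_in A k (\<lambda>xs. F (map (\<lambda>E. E xs) Fs))"
proof -
  obtain p where p: "\<And>xs. length xs = length Fs \<Longrightarrow> eval A p xs (F xs)"
    using assms(1) unfolding computable_in_def by blast
  have "\<forall>E\<in>set Fs. \<exists>q. \<forall>xs. length xs = k \<longrightarrow> eval A q xs (E xs)"
    using assms(2) unfolding computable_in_def by blast
  then obtain Q where Q: "\<And>E xs. E \<in> set Fs \<Longrightarrow> length xs = k \<Longrightarrow> eval A (Q E) xs (E xs)"
    by metis
  have "eval A (Comp p (map Q Fs)) xs (F (map (\<lambda>E. E xs) Fs))" if "length xs = k" for xs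
    using Q that
    by (intro eval_Comp[where ys = "map (\<lambda>E. E xs) Fs"] p)
       (auto simp: list_all2_conv_all_nth)
  then show ?thesis unfolding computable_in_def by blast
qed

lemma computable_in_comp1:
  assumes "computable_in A 1 (\<lambda>xs. F (xs ! 0))" "computable_in A k E"
  shows "computable_in A k (\<lambda>xs. F (E xs))"
  using computable_in_comp[of A "[E]" "\<lambda>xs. F (xs ! 0)" k] assms by simp

lemma computable_in_comp2:
  assumes "computable_in A 2 (\<lambda>xs. F (xs ! 0) (xs ! 1))" "computable_in A k E" "computable_in A k E'"
  shows "computable_in A k (\<lambda>xs. F (E xs) (E' xs))"
  using computable_in_comp[of A "[E, E']" "\<lambda>xs. F (xs ! 0) (xs ! 1)" k] assms
  by (auto simp: numeral_2_eq_2)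

lemma computable_in_Cons:
  assumes "computable_in A (Suc k) F" "computable_in A k E"
  shows "computable_in A k (\<lambda>xs. F (E xs # xs))"
proof -
  have "computable_in A k (\<lambda>xs. F (map (\<lambda>E. E xs) (E # map (\<lambda>i xs. xs ! i) [0..<k])))"
    using assms by (intro computable_in_comp) (auto intro: computable_in_proj)
  then show ?thesis
    by (rule computable_in_cong) (auto simp: comp_def map_nth intro!: arg_cong[where f = F])
qed

lemma computable_in_Suc: "computable_in A k F \<Longrightarrow> computable_in A k (\<lambda>xs. Suc (F xs))"
proof (erule computable_in_comp1[rotated])
  have "eval A Succ xs (Suc (xs ! 0))" if "length xs = 1" for xs
    using that eval_Succ[of A "xs ! 0"] by (auto simp: length_Suc_conv)
  then show "computable_in A 1 (\<lambda>xs. Suc (xs ! 0))"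
    unfolding computable_in_def by blast
qed

lemma computable_in_const: "computable_in A k (\<lambda>xs. c)"
proof (induction c)
  case 0
  show ?case unfolding computable_in_def using eval_Zero by blast
qed (rule computable_in_Suc)

lemma computable_in_rec_nat:
  assumes "computable_in A k P" "computable_in A (Suc (Suc k)) Q"
  shows "computable_in A (Suc k) (\<lambda>xs. rec_nat (P (tl xs)) (\<lambda>m r. Q (m # r # tl xs)) (hd xs))"
proof -
  obtain p where p: "\<And>xs. length xs = k \<Longrightarrow> eval A p xs (P xs)"
    using assms(1) unfolding computable_in_def by blast
  obtain q where q: "\<And>xs. length xs = Suc (Suc k) \<Longrightarrow> eval A q xs (Q xs)"
    using assms(2) unfolding computable_in_def by blast
  have "eval A (PrimRec p q) (m # xs) (rec_nat (P xs) (\<lambda>m r. Q (m # r # xs)) m)"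
    if "length xs = k" for m xs
    by (induction m) (use that in \<open>auto intro!: eval_PrimRec_0 eval_PrimRec_Suc p q\<close>)
  then have "eval A (PrimRec p q) xs (rec_nat (P (tl xs)) (\<lambda>m r. Q (m # r # tl xs)) (hd xs))"
    if "length xs = Suc k" for xs
    using that by (cases xs) auto
  then show ?thesis unfolding computable_in_def by blast
qed

text \<open>With truth values coded as 0 and 1, truncated subtraction is the arithmetic from which
  negation, conjunction and comparison are built below.\<close>

lemma computable_in_diff:
  assumes "computable_in A k E" "computable_in A k E'"
  shows "computable_in A k (\<lambda>xs. E xs - E' xs)"
proof -
  have rec0: "rec_nat 0 (\<lambda>m r. m) n = n - Suc 0" for n :: nat
    by (cases n) auto
  have "computable_in A (Suc 0) (\<lambda>xs. rec_nat ((\<lambda>_. 0) (tl xs)) (\<lambda>m r. (m # r # tl xs) ! 0) (hd xs))"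
    by (intro computable_in_rec_nat computable_in_const computable_in_proj) simp
  then have "computable_in A 1 (\<lambda>xs. xs ! 0 - 1)"
    unfolding One_nat_def by (rule computable_in_cong) (auto simp: length_Suc_conv rec0)
  then have pred: "computable_in A k E \<Longrightarrow> computable_in A k (\<lambda>xs. E xs - 1)" for k E
    by (rule computable_in_comp1)
  have rec1: "rec_nat x (\<lambda>m r. r - Suc 0) n = x - n" for n x :: nat
    by (induction n) auto
  have "computable_in A (Suc (Suc 0)) (\<lambda>xs. rec_nat ((\<lambda>ys. ys ! 0) (tl xs)) (\<lambda>m r. (\<lambda>zs. zs ! 1 - 1) (m # r # tl xs)) (hd xs))"
    by (intro computable_in_rec_nat pred computable_in_proj) simp_all
  then have "computable_in A 2 (\<lambda>xs. xs ! 1 - xs ! 0)"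
    unfolding numeral_2_eq_2 by (rule computable_in_cong) (auto simp: length_Suc_conv rec1)
  \<comment> \<open>The recursion runs on the head of the list, so the subtrahend came first and the
    arguments are swapped back here.\<close>
  from computable_in_comp2[where F = "\<lambda>x y. y - x", OF this assms(2,1)] show ?thesis .
qed

lemma decidable_in_not:
  assumes "decidable_in A k R"
  shows "decidable_in A k (\<lambda>xs. \<not> R xs)"
  by (rule computable_in_cong[OF computable_in_diff[OF computable_in_const[of _ _ 1] assms]]) simp

lemma computable_in_Least:
  assumes "decidable_in A (Suc k) R" "\<And>xs. length xs = k \<Longrightarrow> \<exists>m. R (m # xs)"
  shows "computable_in A k (\<lambda>xs. LEAST m. R (m # xs))"
proof -
  \<comment> \<open>\<open>Mu\<close> looks for the value 0, so it is given the truth value of the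
    negation.\<close>
  have "decidable_in A (Suc k) (\<lambda>xs. \<not> R xs)"
    using assms(1) by (rule decidable_in_not)
  then obtain p where p: "\<And>xs. length xs = Suc k \<Longrightarrow> eval A p xs (of_bool (\<not> R xs))"
    unfolding computable_in_def by blast
  have "eval A (Mu p) xs (LEAST m. R (m # xs))" if xs: "length xs = k" for xs
  proof (intro eval_Mu allI impI exI)
    have "R ((LEAST m. R (m # xs)) # xs)"
      using assms(2)[OF xs] by (rule LeastI_ex)
    with p[of "(LEAST m. R (m # xs)) # xs"] xs
    show "eval A p ((LEAST m. R (m # xs)) # xs) 0" by simp
  next
    fix i assume "i < (LEAST m. R (m # xs))"
    then have "\<not> R (i # xs)" by (rule not_less_Least)
    with p[of "i # xs"] xs show "eval A p (i # xs) (Suc 0)" by simp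
  qed
  then show ?thesis unfolding computable_in_def by blast
qed

lemma decidable_in_conj:
  assumes "decidable_in A k R" "decidable_in A k S"
  shows "decidable_in A k (\<lambda>xs. R xs \<and> S xs)"
  by (rule computable_in_cong[OF computable_in_diff[OF assms(1) decidable_in_not[OF assms(2)]]]) auto

lemma decidable_in_disj:
  assumes "decidable_in A k R" "decidable_in A k S"
  shows "decidable_in A k (\<lambda>xs. R xs \<or> S xs)"
proof -
  have "decidable_in A k (\<lambda>xs. \<not> (\<not> R xs \<and> \<not> S xs))"
    by (intro decidable_in_not decidable_in_conj assms)
  then show ?thesis by (simp only: de_Morgan_conj not_not)
qed

lemma decidable_in_imp:
  assumes "decidable_in A k R" "decidable_in A k S"
  shows "decidable_in A k (\<lambda>xs. R xs \<longrightarrow> S xs)"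
  unfolding imp_conv_disj by (intro decidable_in_disj decidable_in_not assms)

lemma decidable_in_le:
  assumes "computable_in A k E" "computable_in A k E'"
  shows "decidable_in A k (\<lambda>xs. E xs \<le> E' xs)"
  by (rule computable_in_cong[OF computable_in_diff[OF computable_in_const[of _ _ 1] computable_in_diff[OF assms]]]) auto

lemma decidable_in_less:
  assumes "computable_in A k E" "computable_in A k E'"
  shows "decidable_in A k (\<lambda>xs. E xs < E' xs)"
  using decidable_in_not[OF decidable_in_le[OF assms(2,1)]] by (simp add: not_le)

lemma decidable_in_eq:
  assumes "computable_in A k E" "computable_in A k E'"
  shows "decidable_in A k (\<lambda>xs. E xs = E' xs)"
  by (rule computable_in_cong[OF decidable_in_conj[OF decidable_in_le[OF assms] decidable_in_le[OF assms(2,1)]]])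
     auto

lemma decidable_in_finite_all:
  assumes "finite I" "\<And>i. i \<in> I \<Longrightarrow> decidable_in A k (R i)"
  shows "decidable_in A k (\<lambda>xs. \<forall>i\<in>I. R i xs)"
  using assms
proof (induction I rule: finite_induct)
  case (insert i I)
  then show ?case using decidable_in_conj[of A k "R i" "\<lambda>xs. \<forall>i\<in>I. R i xs"] by simp
qed (simp add: computable_in_const)

lemma decidable_in_finite_ex:
  assumes "finite I" "\<And>i. i \<in> I \<Longrightarrow> decidable_in A k (R i)"
  shows "decidable_in A k (\<lambda>xs. \<exists>i\<in>I. R i xs)"
proof -
  have "decidable_in A k (\<lambda>xs. \<not> (\<forall>i\<in>I. \<not> R i xs))"
    using assms by (intro decidable_in_not decidable_in_finite_all)
  then show ?thesis by (simp only: ball_simps not_not)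
qed

section \<open>Bounded quantification\<close>

lemma computable_in_drop_second:
  assumes "computable_in A (Suc k) F"
  shows "computable_in A (Suc (Suc k)) (\<lambda>zs. F (hd zs # tl (tl zs)))"
proof -
  have "computable_in A (Suc (Suc k))
      (\<lambda>zs. F (map (\<lambda>E. E zs) ((\<lambda>zs. zs ! 0) # map (\<lambda>i zs. zs ! Suc (Suc i)) [0..<k])))"
    using assms by (intro computable_in_comp) (auto intro: computable_in_proj)
  then show ?thesis
    by (rule computable_in_cong) (auto simp: length_Suc_conv comp_def map_nth)
qed

lemma decidable_in_bex:
  assumes "decidable_in A (Suc k) R" "computable_in A k B"
  shows "decidable_in A k (\<lambda>xs. \<exists>y<B xs. R (y # xs))"
proof -
  \<comment> \<open>The entry \<open>zs ! 1\<close> is the truth value accumulated so far by the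
    recursion; \<open>R\<close> is asked about the remaining entries.\<close>
  have Q: "decidable_in A (Suc (Suc k)) (\<lambda>zs. 0 < zs ! 1 \<or> R (hd zs # tl (tl zs)))"
    by (intro decidable_in_disj decidable_in_less computable_in_proj computable_in_const
        computable_in_drop_second assms(1)) simp
  have rec: "rec_nat 0 (\<lambda>m r. of_bool (0 < r \<or> R (m # xs))) n = (of_bool (\<exists>y<n. R (y # xs)) :: nat)"
    for n xs by (induction n) (auto simp: less_Suc_eq)
  have "computable_in A (Suc k) (\<lambda>xs. rec_nat ((\<lambda>_. 0) (tl xs))
      (\<lambda>m r. (\<lambda>zs. of_bool (0 < zs ! 1 \<or> R (hd zs # tl (tl zs)))) (m # r # tl xs)) (hd xs))"
    by (intro computable_in_rec_nat computable_in_const Q)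
  then have "decidable_in A (Suc k) (\<lambda>xs. \<exists>y<hd xs. R (y # tl xs))"
    by (rule computable_in_cong)
       (auto simp: length_Suc_conv rec simp del: of_bool_or_iff)
  from computable_in_Cons[OF this assms(2)] show ?thesis by simp
qed

lemma decidable_in_bex_list:
  assumes "decidable_in A (j + k) R" "b < k"
  shows "decidable_in A k
    (\<lambda>ys. \<exists>xs. length xs = j \<and> (\<forall>x\<in>set xs. x < ys ! b) \<and> R (xs @ ys))"
  using assms(1)
proof (induction j arbitrary: R)
  case (Suc j)
  \<comment> \<open>Behind the \<open>j\<close> numbers already quantified, the bound
    \<open>ys ! b\<close> is found at position \<open>j + b\<close>.\<close>
  have "decidable_in A (j + k) (\<lambda>zs. \<exists>x<zs ! (j + b). R (x # zs))"
    using Suc.prems assms(2) by (intro decidable_in_bex computable_in_proj) auto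
  note IH = Suc.IH[OF this]
  have "(\<exists>xs. length xs = j \<and> (\<forall>x\<in>set xs. x < ys ! b) \<and> (\<exists>x<(xs @ ys) ! (j + b). R (x # xs @ ys)))
    \<longleftrightarrow> (\<exists>xs. length xs = Suc j \<and> (\<forall>x\<in>set xs. x < ys ! b) \<and> R (xs @ ys))" (is "?L \<longleftrightarrow> ?R") for ys
  proof
    assume ?L
    then obtain xs x where "length xs = j" "\<forall>x\<in>set xs. x < ys ! b" "x < (xs @ ys) ! (j + b)"
      "R (x # xs @ ys)" by blast
    then show ?R by (intro exI[of _ "x # xs"]) auto
  next
    assume ?R
    then obtain x xs where "length xs = j" "\<forall>x\<in>set (x # xs). x < ys ! b" "R (x # xs @ ys)"
      by (metis append_Cons length_Suc_conv)
    then show ?L by (intro exI[of _ xs]) auto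
  qed
  with IH show ?case by simp
qed simp

text \<open>By \<open>cong\<close>, \<open>P\<close> depends only on the first \<open>j\<close>
  values of \<open>x\<close>, so quantifying over sequences amounts to quantifying over lists of
  length \<open>j\<close>.\<close>

lemma decidable_in_bex_seq:
  assumes P: "decidable_in A (j + k) (\<lambda>zs. P (\<lambda>i. zs ! i) (\<lambda>i. zs ! (j + i)))"
    and b: "b < k"
    and cong: "\<And>x x' y. (\<And>i. i < j \<Longrightarrow> x i = x' i) \<Longrightarrow> P x y \<Longrightarrow> P x' y"
  shows "decidable_in A k (\<lambda>ys. \<exists>x. (\<forall>i<j. x i < ys ! b) \<and> P x (\<lambda>i. ys ! i))"
proof -
  have "(\<exists>xs. length xs = j \<and> (\<forall>x\<in>set xs. x < ys ! b) \<and>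
        P (\<lambda>i. (xs @ ys) ! i) (\<lambda>i. (xs @ ys) ! (j + i)))
      \<longleftrightarrow> (\<exists>x. (\<forall>i<j. x i < ys ! b) \<and> P x (\<lambda>i. ys ! i))" (is "?L \<longleftrightarrow> ?R") for ys
  proof
    assume ?L
    then obtain xs where xs: "length xs = j" "\<forall>x\<in>set xs. x < ys ! b"
      "P (\<lambda>i. (xs @ ys) ! i) (\<lambda>i. ys ! i)" by (auto simp: nth_append)
    then show ?R by (intro exI[of _ "\<lambda>i. (xs @ ys) ! i"]) (auto simp: nth_append)
  next
    assume ?R
    then obtain x where x: "\<forall>i<j. x i < ys ! b" "P x (\<lambda>i. ys ! i)" by blast
    have "P (\<lambda>i. (map x [0..<j] @ ys) ! i) (\<lambda>i. ys ! i)"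
      by (rule cong[OF _ x(2)]) (simp add: nth_append)
    with x(1) show ?L by (intro exI[of _ "map x [0..<j]"]) (auto simp: nth_append)
  qed
  with decidable_in_bex_list[OF P b] show ?thesis by simp
qed

section \<open>Limits of decidable relations\<close>

lemma is_Sigma_2I:
  assumes "decidable_in {} (Suc (Suc k)) Q"
    and "\<And>xs. length xs = k \<Longrightarrow> R xs \<longleftrightarrow> (\<exists>t. \<forall>s. Q (s # t # xs))"
  shows "is_Sigma 2 k R"
  unfolding numeral_2_eq_2 is_Sigma.simps is_Pi.simps decidable_def
  using assms by (intro exI[of _ "\<lambda>ys. \<forall>s. Q (s # ys)"] conjI exI[of _ Q]) auto

lemma is_Pi_2I:
  assumes "decidable_in {} (Suc (Suc k)) Q"
    and "\<And>xs. length xs = k \<Longrightarrow> R xs \<longleftrightarrow> (\<forall>t. \<exists>s. Q (s # t # xs))"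
  shows "is_Pi 2 k R"
  unfolding numeral_2_eq_2 is_Sigma.simps is_Pi.simps decidable_def
  using assms by (intro exI[of _ "\<lambda>ys. \<exists>s. Q (s # ys)"] conjI exI[of _ Q]) auto

text \<open>Along a convergent approximation, holding at all large stages and holding at arbitrarily
  large stages both mean holding in the limit. The first form is
  \<open>\<Sigma>\<^sup>0\<^sub>2\<close>, the second \<open>\<Pi>\<^sup>0\<^sub>2\<close>.\<close>

lemma is_Delta_2_limit:
  assumes D: "decidable_in {} (Suc k) D"
    and lim: "\<And>xs. length xs = k \<Longrightarrow> \<forall>\<^sub>F s in sequentially. D (s # xs) \<longleftrightarrow> R xs"
  shows "is_Delta 2 k R"
proof -
  note D' = computable_in_drop_second[OF D]
  have lim': "\<exists>s0. \<forall>s\<ge>s0. D (s # xs) \<longleftrightarrow> R xs" if "length xs = k" for xs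
    using lim[OF that] by (simp add: eventually_sequentially)
  have "decidable_in {} (Suc (Suc k)) (\<lambda>zs. zs ! 1 \<le> zs ! 0 \<longrightarrow> D (hd zs # tl (tl zs)))"
    by (intro decidable_in_imp decidable_in_le computable_in_proj D') auto
  moreover have "R xs \<longleftrightarrow> (\<exists>t. \<forall>s. t \<le> s \<longrightarrow> D (s # xs))" if "length xs = k" for xs
    using lim'[OF that] by (metis nle_le order_trans)
  ultimately have Sigma: "is_Sigma 2 k R"
    by (elim is_Sigma_2I) simp
  have "decidable_in {} (Suc (Suc k)) (\<lambda>zs. zs ! 1 \<le> zs ! 0 \<and> D (hd zs # tl (tl zs)))"
    by (intro decidable_in_conj decidable_in_le computable_in_proj D') auto
  then have "is_Pi 2 k R"
  proof (rule is_Pi_2I)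
    show "R xs \<longleftrightarrow> (\<forall>t. \<exists>s. (s # t # xs) ! 1 \<le> (s # t # xs) ! 0 \<and>
        D (hd (s # t # xs) # tl (tl (s # t # xs))))" if "length xs = k" for xs
      using lim'[OF that] by simp (metis nle_le order_trans)
  qed
  with Sigma show ?thesis by (simp add: is_Delta_def)
qed

text \<open>This is the thinning needed for \<open>realized_N\<close>, where \<open>z\<close> ends a
  tuple above \<open>m\<close> and \<open>v\<close> is a stage certifying that tuple. Each new
  element is searched for above the certificate of the previous one.\<close>

lemma sparse_decidable_set:
  fixes S :: "nat \<Rightarrow> nat \<Rightarrow> nat \<Rightarrow> bool"
  assumes S: "decidable_in A 3 (\<lambda>xs. S (xs ! 0) (xs ! 1) (xs ! 2))"
    and ex: "\<And>m. \<exists>v z. S z v m \<and> z < v"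
    and gt: "\<And>z v m. S z v m \<Longrightarrow> m < z"
  obtains X where "infinite X" "decidable_in A 1 (\<lambda>xs. xs ! 0 \<in> X)"
    "\<And>z. z \<in> X \<Longrightarrow> \<exists>v m. S z v m \<and> (\<forall>z'\<in>X. z < z' \<longrightarrow> v \<le> z')"
proof -
  \<comment> \<open>Searching for \<open>v\<close> first turns the search for \<open>z\<close> into
    a bounded one, which keeps the condition on \<open>v\<close> decidable.\<close>
  define V where "V m = (LEAST v. \<exists>z<v. S z v m)" for m
  define Z where "Z m = (LEAST z. S z (V m) m)" for m
  define v where "v = rec_nat 0 (\<lambda>_. V)"
  define z where "z i = Z (v i)" for i
  have exV: "\<exists>z<V m. S z (V m) m" for m
    unfolding V_def by (rule LeastI_ex) (use ex in blast)
  then have SZ: "S (Z m) (V m) m" for m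
    unfolding Z_def by (metis LeastI)
  have ZV: "Z m < V m" for m
    using exV[of m] unfolding Z_def by (metis Least_le le_less_trans)
  have mZ: "m < Z m" for m
    using SZ gt by blast
  have v_Suc: "v (Suc i) = V (v i)" for i by (simp add: v_def)
  have v_z: "v i < z i" "z i < v (Suc i)" "S (z i) (v (Suc i)) (v i)" for i
    using mZ ZV SZ by (simp_all add: z_def v_Suc)
  have "strict_mono v" using v_z(1,2) less_trans unfolding strict_mono_Suc_iff by blast
  then have v_z_less: "v (Suc i) \<le> z j" if "i < j" for i j
    using that v_z(1)[of j] by (meson Suc_leI less_imp_le order_trans strict_mono_less_eq)
  then have mono_z: "strict_mono z"
    using v_z(2) by (meson less_le_trans strict_monoI)
  then have z_ge: "i \<le> z i" for i by (rule strict_mono_imp_increasing)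
  have "decidable_in A 2 (\<lambda>xs. \<exists>z<xs ! 0. S z (xs ! 0) (xs ! 1))"
    using decidable_in_bex[of A 2 "\<lambda>xs. S (xs ! 0) (xs ! 1) (xs ! 2)" "\<lambda>xs. xs ! 0"] S
    by (simp add: computable_in_proj eval_nat_numeral)
  then have V: "computable_in A 1 (\<lambda>xs. V (xs ! 0))"
    using computable_in_Least[of A 1 "\<lambda>xs. \<exists>z<xs ! 0. S z (xs ! 0) (xs ! 1)"] ex
    by (simp add: V_def eval_nat_numeral) blast
  have "decidable_in A 2 (\<lambda>xs. S (xs ! 0) (V (xs ! 1)) (xs ! 1))"
  proof -
    have "decidable_in A (length [\<lambda>xs. xs ! 0, \<lambda>xs. V (xs ! 1), \<lambda>xs. xs ! 1])
        (\<lambda>xs. S (xs ! 0) (xs ! 1) (xs ! 2))"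
      using S by (simp add: eval_nat_numeral)
    then have "decidable_in A 2 (\<lambda>xs. (\<lambda>ys. S (ys ! 0) (ys ! 1) (ys ! 2))
        (map (\<lambda>E. E xs) [\<lambda>xs. xs ! 0, \<lambda>xs. V (xs ! 1), \<lambda>xs. xs ! 1]))"
      by (rule computable_in_comp) (use computable_in_comp1[OF V computable_in_proj[of 1 2 A]] in \<open>auto intro: computable_in_proj\<close>)
    then show ?thesis by simp
  qed
  then have Z: "computable_in A 1 (\<lambda>xs. Z (xs ! 0))"
    using computable_in_Least[of A 1 "\<lambda>xs. S (xs ! 0) (V (xs ! 1)) (xs ! 1)"] exV
    by (simp add: Z_def eval_nat_numeral) blast
  have "computable_in A (Suc 0) (\<lambda>xs. rec_nat ((\<lambda>_. 0) (tl xs)) (\<lambda>m r. (\<lambda>ys. V (ys ! 1)) (m # r # tl xs)) (hd xs))"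
    by (intro computable_in_rec_nat computable_in_const computable_in_comp1[OF V] computable_in_proj) simp
  then have v: "computable_in A 1 (\<lambda>xs. v (xs ! 0))"
    unfolding One_nat_def by (rule computable_in_cong) (auto simp: length_Suc_conv v_def)
  have "decidable_in A (Suc 1) (\<lambda>xs. z (xs ! 0) = xs ! 1)"
    unfolding z_def
    by (intro decidable_in_eq computable_in_comp1[OF Z] computable_in_comp1[OF v] computable_in_proj) simp_all
  \<comment> \<open>Since \<open>i \<le> z i\<close>, only indices up to the number itself have to
    be tried.\<close>
  then have "decidable_in A 1 (\<lambda>xs. \<exists>i<Suc (xs ! 0). z ((i # xs) ! 0) = (i # xs) ! 1)"
    by (intro decidable_in_bex[where R = "\<lambda>xs. z (xs ! 0) = xs ! 1"] computable_in_Suc computable_in_proj) auto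
  then have dec: "decidable_in A 1 (\<lambda>xs. xs ! 0 \<in> range z)"
  proof (rule computable_in_cong)
    have "(\<exists>i<Suc y. z i = y) \<longleftrightarrow> y \<in> range z" for y
      using z_ge by (metis le_imp_less_Suc rangeE rangeI)
    then show "of_bool (\<exists>i<Suc (xs ! 0). z ((i # xs) ! 0) = (i # xs) ! 1) = of_bool (xs ! 0 \<in> range z)" for xs
      by simp
  qed
  show ?thesis
  proof (rule that[OF _ dec])
    show "infinite (range z)"
      using mono_z strict_mono_imp_inj_on range_inj_infinite by blast
  next
    fix y assume "y \<in> range z"
    then obtain i where i: "y = z i" by blast
    have "\<forall>z'\<in>range z. y < z' \<longrightarrow> v (Suc i) \<le> z'"
      using v_z_less mono_z by (auto simp: i strict_mono_less)
    with v_z(3)[of i] show "\<exists>v m. S y v m \<and> (\<forall>z'\<in>range z. y < z' \<longrightarrow> v \<le> z')"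
      unfolding i by blast
  qed
qed

section \<open>From the empty oracle to an arbitrary one\<close>

primrec drop_oracle :: "prog \<Rightarrow> prog" where
  "drop_oracle Zero = Zero"
| "drop_oracle Succ = Succ"
| "drop_oracle (Proj i) = Proj i"
| "drop_oracle Oracle = Zero" \<comment> \<open>the answer of the empty oracle\<close>
| "drop_oracle (Comp p ps) = Comp (drop_oracle p) (map drop_oracle ps)"
| "drop_oracle (PrimRec p q) = PrimRec (drop_oracle p) (drop_oracle q)"
| "drop_oracle (Mu p) = Mu (drop_oracle p)"

text \<open>The empty oracle answers 0 to every query, so the program without queries repeats the
  computation, and no oracle can influence it.\<close>

lemma eval_drop_oracle: "eval {} p xs y \<Longrightarrow> eval A (drop_oracle p) xs y"
proof (induction rule: eval.induct)
  case (eval_Comp xs ps ys q z)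
  then show ?case
    by (auto intro!: eval.eval_Comp[where ys = ys] simp: list_all2_conv_all_nth)
qed (auto intro: eval.intros)

lemma computable_in_empty: "computable_in {} k F \<Longrightarrow> computable_in A k F"
  unfolding computable_in_def using eval_drop_oracle by blast

section \<open>Largeness patterns\<close>

text \<open>A tree \<open>t\<close> is used in two ways: \<open>full\<close> reads it as the shape of a tuple with \<open>size t\<close>
  entries, and \<open>block\<close> as the shape of a block with \<open>size t + 1\<close> entries. The argument \<open>\<gamma>\<close> is \<open>g\<close>
  or, for the computable approximation of the coloring, \<open>G s\<close>.\<close>

datatype pattern = E | N pattern pattern

text \<open>The two subblocks share the entry with index \<open>Suc (size l)\<close>, the last one
  that does not reveal the first pair. The next entry belongs to the block only if
  \<open>r \<noteq> E\<close>; the guard keeps the definition from reading past index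
  \<open>size t\<close>. Apart from the recursive calls, \<open>\<gamma>\<close> enters only through
  smallness of the first pair.\<close>

fun block :: "(nat \<Rightarrow> nat \<Rightarrow> nat) \<Rightarrow> (nat \<Rightarrow> nat) \<Rightarrow> pattern \<Rightarrow> (nat \<Rightarrow> nat) \<Rightarrow> bool" where
  "block G \<gamma> E x \<longleftrightarrow> True"
| "block G \<gamma> (N l r) x \<longleftrightarrow>
    block G \<gamma> l (\<lambda>i. x (Suc i)) \<and> block G \<gamma> r (\<lambda>i. x (Suc (size l) + i)) \<and>
    x 1 < \<gamma> (x 0) \<and> G (x (Suc (size l))) (x 0) \<le> x 1 \<and>
    (r \<noteq> E \<longrightarrow> x 1 < G (x (Suc (Suc (size l)))) (x 0))"

text \<open>Unlike the two parts of a block, consecutive blocks share no entry: a large pair lies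
  between them.\<close>

fun full :: "(nat \<Rightarrow> nat \<Rightarrow> nat) \<Rightarrow> (nat \<Rightarrow> nat) \<Rightarrow> pattern \<Rightarrow> (nat \<Rightarrow> nat) \<Rightarrow> bool" where
  "full G \<gamma> E x \<longleftrightarrow> True"
| "full G \<gamma> (N l r) x \<longleftrightarrow>
    block G \<gamma> l x \<and> full G \<gamma> r (\<lambda>i. x (Suc (size l) + i)) \<and>
    (r \<noteq> E \<longrightarrow> \<gamma> (x (size l)) \<le> x (Suc (size l)))"

lemma size_pattern_eq_0_iff [simp]: "size t = 0 \<longleftrightarrow> t = E" for t :: pattern
  by (cases t) auto

text \<open>Splitting a tree at its root into subtrees of sizes \<open>i\<close> and
  \<open>m - i\<close> gives the Catalan recursion. Finiteness is carried along because the
  cardinality of the union needs it.\<close>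

lemma finite_card_patterns:
  "finite {t :: pattern. size t = n} \<and> card {t :: pattern. size t = n} = catalan n"
proof (induction n rule: less_induct)
  case (less n)
  show ?case
  proof (cases n)
    case (Suc m)
    define P where "P k = {t :: pattern. size t = k}" for k
    have P: "finite (P k)" "card (P k) = catalan k" if "k \<le> m" for k
      using less[of k] that Suc unfolding P_def by auto
    have eq: "{t. size t = n} = (\<Union>i\<in>{0..m}. case_prod N ` (P i \<times> P (m - i)))"
    proof (intro set_eqI iffI)
      fix t :: pattern assume "t \<in> {t. size t = n}"
      then show "t \<in> (\<Union>i\<in>{0..m}. case_prod N ` (P i \<times> P (m - i)))"
        using Suc by (cases t) (auto simp: P_def intro!: bexI[of _ "size (_ :: pattern)"])
    qed (auto simp: P_def Suc)
    have inj: "inj_on (case_prod N) S" for S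
      by (auto simp: inj_on_def)
    have "card (\<Union>i\<in>{0..m}. case_prod N ` (P i \<times> P (m - i))) = (\<Sum>i\<in>{0..m}. catalan i * catalan (m - i))"
      using P by (subst card_UN_disjoint)
        (auto simp: card_image[OF inj] card_cartesian_product, auto simp: P_def)
    moreover have "finite (\<Union>i\<in>{0..m}. case_prod N ` (P i \<times> P (m - i)))"
      using P by auto
    ultimately show ?thesis unfolding eq by (simp add: Suc)
  qed simp
qed

text \<open>This serves both to change a sequence beyond the block and to replace \<open>g\<close>
  by \<open>G s\<close> once the two agree on its entries.\<close>

lemma block_cong:
  "\<forall>i\<le>size t. x i = x' i \<Longrightarrow> \<forall>i\<le>size t. \<gamma> (x i) = \<gamma>' (x i) \<Longrightarrow> block G \<gamma> t x \<longleftrightarrow> block G \<gamma>' t x'"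
proof (induction t arbitrary: x x')
  case (N l r)
  have "block G \<gamma> l (\<lambda>i. x (Suc i)) \<longleftrightarrow> block G \<gamma>' l (\<lambda>i. x' (Suc i))"
    using N.prems by (intro N.IH) auto
  moreover have "block G \<gamma> r (\<lambda>i. x (Suc (size l) + i)) \<longleftrightarrow> block G \<gamma>' r (\<lambda>i. x' (Suc (size l) + i))"
    using N.prems by (intro N.IH) auto
  moreover have "r \<noteq> E \<Longrightarrow> x (Suc (Suc (size l))) = x' (Suc (Suc (size l)))"
    using N.prems(1) by (cases r) auto
  ultimately show ?case using N.prems by auto
qed simp

lemma full_cong:
  "\<forall>i<size t. x i = x' i \<Longrightarrow> \<forall>i<size t. \<gamma> (x i) = \<gamma>' (x i) \<Longrightarrow> full G \<gamma> t x \<longleftrightarrow> full G \<gamma>' t x'"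
proof (induction t arbitrary: x x')
  case (N l r)
  have "block G \<gamma> l x \<longleftrightarrow> block G \<gamma>' l x'"
    using N.prems by (intro block_cong) auto
  moreover have "full G \<gamma> r (\<lambda>i. x (Suc (size l) + i)) \<longleftrightarrow> full G \<gamma>' r (\<lambda>i. x' (Suc (size l) + i))"
    using N.prems by (intro N.IH) auto
  moreover have "r \<noteq> E \<Longrightarrow> x (Suc (size l)) = x' (Suc (size l))"
    using N.prems(1) by (cases r) auto
  ultimately show ?case using N.prems by auto
qed simp

text \<open>\<open>\<gamma>\<close> occurs only as an upper bound, so a block recognized at some
  stage is a block in the limit. This fails for \<open>full\<close>, which also bounds
  \<open>\<gamma>\<close> from above.\<close>

lemma block_mono:
  "block G \<gamma> t x \<Longrightarrow> (\<And>y. \<gamma> y \<le> \<gamma>' y) \<Longrightarrow> block G \<gamma>' t x"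
proof (induction t arbitrary: x)
  case (N l r)
  then have "x 1 < \<gamma> (x 0)" by simp
  also have "\<dots> \<le> \<gamma>' (x 0)" by (rule N.prems(2))
  finally have "x 1 < \<gamma>' (x 0)" .
  with N show ?case by auto
qed simp

lemma block_adjacent_small:
  "block G \<gamma> t x \<Longrightarrow> i < size t \<Longrightarrow> x (Suc i) < \<gamma> (x i)"
proof (induction t arbitrary: x i)
  case (N l r)
  \<comment> \<open>Because the subblocks overlap in one entry, every adjacent pair after the first
    lies inside one of them.\<close>
  consider "i = 0" | j where "i = Suc j" "j < size l" | j where "i = Suc (size l) + j" "j < size r"
  proof (cases i)
    case (Suc k)
    then show ?thesis using N.prems(2) that(2)[of k] that(3)[of "k - size l"] by (cases "k < size l") auto
  qed (use that in auto)
  then show ?case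
  proof cases
    case 1
    with N.prems show ?thesis by simp
  next
    case 2
    with N.prems N.IH(1)[of "\<lambda>i. x (Suc i)" j] show ?thesis by simp
  next
    case 3
    with N.prems N.IH(2)[of "\<lambda>i. x (Suc (size l) + i)" j] show ?thesis by simp
  qed
qed simp

text \<open>As \<open>G\<close> is nondecreasing in the stage, the entries of an increasing tuple
  that reveal the first pair form a final segment. Its beginning determines the sizes of both
  subtrees.\<close>

lemma block_unique:
  assumes "\<And>y. incseq (\<lambda>s. G s y)"
  shows "block G \<gamma> t x \<Longrightarrow> block G \<gamma> t' x \<Longrightarrow> size t = size t' \<Longrightarrow>
    (\<And>i j. i < j \<Longrightarrow> j \<le> size t \<Longrightarrow> x i < x j) \<Longrightarrow> t = t'"
proof (induction t arbitrary: x t')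
  case (N l r)
  from N.prems(3) obtain l' r' where t': "t' = N l' r'" by (cases t') auto
  \<comment> \<open>If \<open>l\<close> were the smaller tree, the entry after its overlap would
    reveal the pair, hence so would the later overlap entry of the other tree, which must not. The
    variables are generalized so that the trees can be exchanged.\<close>
  have aux: "\<not> size l < size l'"
    if "block G \<gamma> (N l r) x" "block G \<gamma> (N l' r') x" "size (N l r) = size (N l' r')"
      "\<And>i j. i < j \<Longrightarrow> j \<le> size (N l r) \<Longrightarrow> x i < x j" for l r l' r'
  proof
    assume less: "size l < size l'"
    then have "r \<noteq> E" using that(3) by auto
    then have "x 1 < G (x (Suc (Suc (size l)))) (x 0)" using that(1) by simp
    also have "x (Suc (Suc (size l))) \<le> x (Suc (size l'))"
      using less that(3) that(4)[of "Suc (Suc (size l))" "Suc (size l')"]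
      by (cases "Suc (size l) = size l'") (auto intro: less_imp_le)
    then have "G (x (Suc (Suc (size l)))) (x 0) \<le> G (x (Suc (size l'))) (x 0)"
      using assms by (auto simp: incseq_def)
    also have "\<dots> \<le> x 1" using that(2) by simp
    finally show False by simp
  qed
  have "\<not> size l < size l'" "\<not> size l' < size l"
    using N.prems aux[of l r l' r'] aux[of l' r' l r] by (auto simp: t')
  then have sizes: "size l = size l'" "size r = size r'" using N.prems(3) t' by auto
  have "l = l'" using N.prems sizes by (intro N.IH(1)[of "\<lambda>i. x (Suc i)"]) (auto simp: t')
  moreover have "r = r'"
    using N.prems sizes by (intro N.IH(2)[of "\<lambda>i. x (Suc (size l) + i)"]) (auto simp: t')
  ultimately show ?case by (simp add: t')
qed auto

text \<open>If the first blocks differed in length, the pair at the end of the shorter one would be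
  large by one tree and, being inside the longer block, small by the other.\<close>

lemma full_unique:
  assumes "\<And>y. incseq (\<lambda>s. G s y)"
  shows "full G \<gamma> t x \<Longrightarrow> full G \<gamma> t' x \<Longrightarrow> size t = size t' \<Longrightarrow>
    (\<And>i j. i < j \<Longrightarrow> j < size t \<Longrightarrow> x i < x j) \<Longrightarrow> t = t'"
proof (induction t arbitrary: x t')
  case (N l r)
  from N.prems(3) obtain l' r' where t': "t' = N l' r'" by (cases t') auto
  have aux: "\<not> size l < size l'"
    if "full G \<gamma> (N l r) x" "full G \<gamma> (N l' r') x" "size (N l r) = size (N l' r')" for l r l' r'
  proof
    assume less: "size l < size l'"
    then have "r \<noteq> E" using that(3) by auto
    then have "\<gamma> (x (size l)) \<le> x (Suc (size l))" using that(1) by simp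
    moreover have "x (Suc (size l)) < \<gamma> (x (size l))"
      using that(2) less by (intro block_adjacent_small[of G \<gamma> l']) auto
    ultimately show False by simp
  qed
  have "\<not> size l < size l'" "\<not> size l' < size l"
    using N.prems aux[of l r l' r'] aux[of l' r' l r] by (auto simp: t')
  then have sizes: "size l = size l'" "size r = size r'" using N.prems(3) t' by auto
  have "l = l'" using N.prems sizes by (intro block_unique[OF assms, where x = x]) (auto simp: t')
  moreover have "r = r'"
    using N.prems sizes by (intro N.IH(2)[of "\<lambda>i. x (Suc (size l) + i)"]) (auto simp: t')
  ultimately show ?case by (simp add: t')
qed auto

lemma decidable_in_block:
  assumes "computable_in A 2 (\<lambda>xs. G (xs ! 0) (xs ! 1))"
  shows "s < k \<Longrightarrow> a + size t < k \<Longrightarrow>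
    decidable_in A k (\<lambda>xs. block G (G (xs ! s)) t (\<lambda>i. xs ! (a + i)))"
proof (induction t arbitrary: a)
  case (N l r)
  note G = computable_in_comp2[OF assms]
  have 1: "decidable_in A k (\<lambda>xs. block G (G (xs ! s)) l (\<lambda>i. xs ! (a + Suc i)))"
    using N.IH(1)[of "Suc a"] N.prems by simp
  have 2: "decidable_in A k (\<lambda>xs. block G (G (xs ! s)) r (\<lambda>i. xs ! (a + (Suc (size l) + i))))"
    using N.IH(2)[of "a + Suc (size l)"] N.prems by (simp add: add.assoc)
  have 3: "decidable_in A k (\<lambda>xs. r \<noteq> E \<longrightarrow> xs ! (a + 1) < G (xs ! (a + Suc (Suc (size l)))) (xs ! (a + 0)))"
  \<comment> \<open>For \<open>r = E\<close> the position \<open>a + Suc (Suc (size l))\<close> may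
    lie outside the list, where no projection is available.\<close>
  proof (cases r)
    case (N r1 r2)
    show ?thesis using N.prems N
      by (intro decidable_in_imp computable_in_const decidable_in_less G computable_in_proj) auto
  qed (simp add: computable_in_const)
  show ?case unfolding block.simps
    using N.prems by (intro decidable_in_conj 1 2 3 decidable_in_less decidable_in_le G computable_in_proj) auto
qed (simp add: computable_in_const)

lemma decidable_in_full:
  assumes "computable_in A 2 (\<lambda>xs. G (xs ! 0) (xs ! 1))"
  shows "s < k \<Longrightarrow> a + size t \<le> k \<Longrightarrow>
    decidable_in A k (\<lambda>xs. full G (G (xs ! s)) t (\<lambda>i. xs ! (a + i)))"
proof (induction t arbitrary: a)
  case (N l r)
  note G = computable_in_comp2[OF assms]
  have 1: "decidable_in A k (\<lambda>xs. block G (G (xs ! s)) l (\<lambda>i. xs ! (a + i)))"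
    using N.prems by (intro decidable_in_block assms) auto
  have 2: "decidable_in A k (\<lambda>xs. full G (G (xs ! s)) r (\<lambda>i. xs ! (a + (Suc (size l) + i))))"
    using N.IH(2)[of "a + Suc (size l)"] N.prems by (simp add: add.assoc)
  have 3: "decidable_in A k (\<lambda>xs. r \<noteq> E \<longrightarrow> G (xs ! s) (xs ! (a + size l)) \<le> xs ! (a + Suc (size l)))"
  proof (cases r)
    case (N r1 r2)
    show ?thesis using N.prems N
      by (intro decidable_in_imp computable_in_const decidable_in_le G computable_in_proj) auto
  qed (simp add: computable_in_const)
  show ?case unfolding full.simps by (intro decidable_in_conj 1 2 3)
qed (simp add: computable_in_const)

section \<open>Realizing patterns\<close>

text \<open>The quantifiers range over explicit finite sets to match
  \<open>decidable_in_finite_all\<close>.\<close>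

definition ascending :: "nat set \<Rightarrow> nat \<Rightarrow> nat \<Rightarrow> (nat \<Rightarrow> nat) \<Rightarrow> bool" where
  "ascending X k m x \<longleftrightarrow> (\<forall>i\<in>{..<k}. x i \<in> X \<and> m < x i \<and> (\<forall>j\<in>{..<i}. x j < x i))"

lemma ascendingD:
  assumes "ascending X k m x"
  shows "i < k \<Longrightarrow> x i \<in> X" "i < k \<Longrightarrow> m < x i" "i < j \<Longrightarrow> j < k \<Longrightarrow> x i < x j"
  using assms by (auto simp: ascending_def)

lemma ascending_cong:
  assumes "\<And>i. i < k \<Longrightarrow> x i = x' i" "ascending X k m x"
  shows "ascending X k m x'"
  using assms unfolding ascending_def by (metis lessThan_iff less_trans)

lemma ascending_Cons:
  assumes "ascending X k n x" "a \<in> X" "m < a" "a \<le> n"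
  shows "ascending X (Suc k) m (case_nat a x)"
proof -
  have "\<forall>i<k. m < x i \<and> a < x i"
    using assms ascendingD(2)[OF assms(1)] by fastforce
  then show ?thesis using assms unfolding ascending_def by (auto split: nat.split)
qed

lemma decidable_in_ascending:
  assumes X: "decidable_in A 1 (\<lambda>xs. xs ! 0 \<in> X)" and M: "computable_in A n M" and "k \<le> n"
  shows "decidable_in A n (\<lambda>xs. ascending X k (M xs) (\<lambda>i. xs ! i))"
proof -
  have X': "computable_in A n F \<Longrightarrow> decidable_in A n (\<lambda>xs. F xs \<in> X)" for F
    using computable_in_comp1[of A "\<lambda>x. of_bool (x \<in> X)" n F] X by simp
  show ?thesis unfolding ascending_def using assms
    by (intro decidable_in_finite_all decidable_in_conj X' decidable_in_less computable_in_proj) auto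
qed

section \<open>Blocks along the approximation of \<open>g\<close>\<close>

locale left_ce_approximation =
  fixes g :: "nat \<Rightarrow> nat" and G :: "nat \<Rightarrow> nat \<Rightarrow> nat"
  assumes computable_G: "computable_in {} 2 (\<lambda>xs. G (xs ! 0) (xs ! 1))"
    and incseq_G: "incseq (\<lambda>s. G s y)"
    and lim_G: "(\<lambda>s. G s y) \<longlonglongrightarrow> g y"
    and mono_g: "mono g"
begin

lemma G_le_g: "G s y \<le> g y"
  using incseq_le[OF incseq_G lim_G] .

lemma G_mono: "s \<le> t \<Longrightarrow> G s y \<le> G t y"
  using incseq_G by (simp add: incseq_def)

lemma eventually_G_eq: "finite Y \<Longrightarrow> \<forall>\<^sub>F s in sequentially. \<forall>y\<in>Y. G s y = g y"
  using lim_G by (simp add: eventually_ball_finite tendsto_discrete)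

text \<open>Only the values of \<open>g\<close> at finitely many entries matter, and the
  approximation has settled there at all large stages.\<close>

lemma eventually_block: "\<forall>\<^sub>F s in sequentially. block G (G s) t x \<longleftrightarrow> block G g t x"
  by (rule eventually_mono[OF eventually_G_eq[of "x ` {..size t}"]]) (auto intro!: block_cong)

lemma eventually_full: "\<forall>\<^sub>F s in sequentially. full G (G s) t x \<longleftrightarrow> full G g t x"
  by (rule eventually_mono[OF eventually_G_eq[of "x ` {..<size t}"]]) (auto intro!: full_cong)

text \<open>Having tuples above every \<open>m\<close> lets the inductive steps place a block beyond
  entries, and values of \<open>g\<close>, chosen before.\<close>

definition realized :: "nat set \<Rightarrow> pattern \<Rightarrow> bool" where
  "realized X t \<longleftrightarrow> (\<forall>m. \<exists>x. ascending X (Suc (size t)) m x \<and> block G g t x)"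

lemma realizedE:
  assumes "realized X t"
  obtains x where "ascending X (Suc (size t)) m x" "block G g t x"
  using assms unfolding realized_def by blast

lemma realized_E:
  assumes "infinite X"
  shows "realized X E"
  unfolding realized_def
proof
  fix m
  obtain y where "y \<in> X" "m < y" using assms infinite_nat_iff_unbounded by blast
  then show "\<exists>x. ascending X (Suc (size E)) m x \<and> block G g E x"
    by (intro exI[of _ "\<lambda>_. y"]) (auto simp: ascending_def)
qed

text \<open>If the shape is missing above \<open>m\<close>, every candidate whose first pair is not
  seen to be small by its last entry really has a large first pair. Its second entry then bounds
  \<open>g\<close> at its first entry, and by monotonicity at every smaller argument.\<close>

lemma realized_N_E:
  assumes no_dom: "\<not> (\<exists>h. computes H h \<and> dominates h g)"
    and X: "infinite X" "decidable_in H 1 (\<lambda>xs. xs ! 0 \<in> X)"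
    and l: "realized X l"
  shows "realized X (N l E)"
proof (rule ccontr)
  assume "\<not> realized X (N l E)"
  then obtain m where m: "\<And>x. ascending X (Suc (Suc (size l))) m x \<Longrightarrow> \<not> block G g (N l E) x"
    unfolding realized_def by auto
  define k where "k = Suc (Suc (size l))"
  \<comment> \<open>\<open>y 0\<close> is the stage of the search and \<open>y 1\<close> the
    argument at which \<open>g\<close> is to be bounded.\<close>
  define P where "P x y \<longleftrightarrow> ascending X k m x \<and> block G (G (y 0)) l (\<lambda>i. x (Suc i)) \<and>
    G (x (Suc (size l))) (x 0) \<le> x 1 \<and> y 1 \<le> x 0" for x y :: "nat \<Rightarrow> nat"
  \<comment> \<open>One number \<open>s\<close> bounds the entries of the candidate, is the stage
    certifying its subblock, and serves as the value of \<open>h\<close>.\<close>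
  define h where "h y = (LEAST s. \<exists>x. (\<forall>i<k. x i < [s, y] ! 0) \<and> P x (\<lambda>i. [s, y] ! i))" for y
  have ex: "\<exists>s x. (\<forall>i<k. x i < [s, y] ! 0) \<and> P x (\<lambda>i. [s, y] ! i)" for y
  proof -
    obtain a where a: "a \<in> X" "max m y < a" using X(1) infinite_nat_iff_unbounded by blast
    \<comment> \<open>Taking the subblock above \<open>g a\<close> makes \<open>(a, x 0)\<close>
      large, so no stage reveals it as small and a candidate always exists.\<close>
    obtain x where x: "ascending X (Suc (size l)) (max a (g a)) x" "block G g l x"
      using l by (rule realizedE)
    define w where "w = case_nat a x"
    have w_Suc: "(\<lambda>i. w (Suc i)) = x" by (simp add: w_def)
    have "ascending X k m w"
      using ascending_Cons[OF x(1) a(1)] a(2) by (simp add: w_def k_def)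
    moreover have "G (w (Suc (size l))) (w 0) \<le> w 1"
      using G_le_g[of "w (Suc (size l))" a] ascendingD(2)[OF x(1), of 0] by (simp add: w_def)
    moreover have "\<forall>\<^sub>F s in sequentially. block G (G s) l x \<and> (\<forall>i\<in>{..<k}. w i < s)"
      using eventually_block[of l x] x(2)
      by (auto intro!: eventually_conj eventually_ball_finite eventually_gt_at_top)
    then obtain s where "block G (G s) l x" "\<forall>i<k. w i < s"
      by (auto dest!: eventually_happens)
    ultimately have "(\<forall>i<k. w i < [s, y] ! 0) \<and> P w (\<lambda>i. [s, y] ! i)"
      using a by (simp add: P_def w_Suc) (simp add: w_def)
    then show ?thesis by blast
  qed
  have "computable_in H 2 (\<lambda>xs. of_bool (\<exists>x. (\<forall>i<k. x i < xs ! 0) \<and> P x (\<lambda>i. xs ! i)))"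
  proof (rule decidable_in_bex_seq)
    have b: "decidable_in H (k + 2) (\<lambda>zs. block G (G (zs ! k)) l (\<lambda>i. zs ! Suc i))"
      using decidable_in_block[OF computable_in_empty[OF computable_G], of k "k + 2" 1 l]
      by (simp add: k_def)
    show "decidable_in H (k + 2) (\<lambda>zs. P (\<lambda>i. zs ! i) (\<lambda>i. zs ! (k + i)))"
      unfolding P_def
      by (intro decidable_in_conj decidable_in_ascending X(2) computable_in_const decidable_in_le
          computable_in_comp2[OF computable_in_empty[OF computable_G]] computable_in_proj)
        (use b in \<open>auto simp: k_def\<close>)
  next
    fix x x' y assume eq: "\<And>i. i < k \<Longrightarrow> x i = x' i" and P: "P x y"
    have "block G (G (y 0)) l (\<lambda>i. x (Suc i)) = block G (G (y 0)) l (\<lambda>i. x' (Suc i))"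
      by (rule block_cong) (auto simp: eq k_def)
    then show "P x' y"
      using P eq ascending_cong[OF eq] by (simp add: P_def k_def)
  qed simp
  then have "computable_in H 1 (\<lambda>xs. LEAST s. \<exists>x. (\<forall>i<k. x i < (s # xs) ! 0) \<and> P x (\<lambda>i. (s # xs) ! i))"
    unfolding numeral_2_eq_2 One_nat_def by (rule computable_in_Least) (use ex in \<open>auto simp: length_Suc_conv\<close>)
  then have "computes H h"
    unfolding computes_def by (rule computable_in_cong) (auto simp: h_def length_Suc_conv)
  moreover have "g y \<le> h y" for y
  proof -
    have "\<exists>x. (\<forall>i<k. x i < [h y, y] ! 0) \<and> P x (\<lambda>i. [h y, y] ! i)"
      unfolding h_def by (rule LeastI_ex) (rule ex)
    then obtain x where x: "\<forall>i<k. x i < h y" "ascending X k m x" "y \<le> x 0"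
      "block G (G (h y)) l (\<lambda>i. x (Suc i))" "G (x (Suc (size l))) (x 0) \<le> x 1"
      by (auto simp: P_def)
    have "block G g l (\<lambda>i. x (Suc i))" using x(4) G_le_g by (rule block_mono)
    \<comment> \<open>By the choice of \<open>m\<close> the tuple does not have the shape
      \<open>N l E\<close>, and smallness of its first pair is the only requirement left to
      fail.\<close>
    then have "g (x 0) \<le> x 1" using m[of x] x by (auto simp: k_def)
    moreover have "g y \<le> g (x 0)" using mono_g x(3) by (rule monoD)
    moreover have "x 1 < h y" using x(1) by (simp add: k_def)
    ultimately show ?thesis by linarith
  qed
  ultimately show False using no_dom by (auto simp: dominates_def)
qed

text \<open>Thin \<open>X\<close> to last entries of tuples realizing \<open>N l E\<close>, spaced so that each next one is a stage
  revealing the smallness in the previous tuple; then realize \<open>r\<close> inside the thinned set.\<close>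

lemma realized_N:
  assumes no_dom: "\<not> (\<exists>h. computes H h \<and> dominates h g)"
    and X: "infinite X" "decidable_in H 1 (\<lambda>xs. xs ! 0 \<in> X)"
    and l: "realized X (N l E)"
    and r: "\<And>X. infinite X \<Longrightarrow> decidable_in H 1 (\<lambda>xs. xs ! 0 \<in> X) \<Longrightarrow> realized X r"
  shows "realized X (N l r)"
  unfolding realized_def
proof
  fix m
  define k where "k = Suc (Suc (size l))"
  \<comment> \<open>Here \<open>v\<close> is the certifying stage and \<open>z\<close> the last
    entry. The thinning supplies the bounds \<open>n\<close> itself, so the bound \<open>m\<close>
    of the goal is imposed separately.\<close>
  define P where "P x z v n \<longleftrightarrow> ascending X k n x \<and> m < x 0 \<and>
    block G (G v) (N l E) x \<and> x (Suc (size l)) = z" for x z v n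
  define S where "S z v n \<longleftrightarrow> (\<exists>x. (\<forall>i<k. x i < v) \<and> P x z v n)" for z v n
  have "decidable_in H 3 (\<lambda>xs. \<exists>x. (\<forall>i<k. x i < xs ! 1) \<and> P x (xs ! 0) (xs ! 1) (xs ! 2))"
  proof (rule decidable_in_bex_seq[where P = "\<lambda>x y. P x (y 0) (y 1) (y 2)"])
    have b: "decidable_in H (k + 3) (\<lambda>zs. block G (G (zs ! (k + 1))) (N l E) (\<lambda>i. zs ! i))"
      using decidable_in_block[OF computable_in_empty[OF computable_G], of "k + 1" "k + 3" 0 "N l E"]
      by (simp add: k_def)
    show "decidable_in H (k + 3) (\<lambda>zs. P (\<lambda>i. zs ! i) (zs ! (k + 0)) (zs ! (k + 1)) (zs ! (k + 2)))"
      unfolding P_def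
      by (intro decidable_in_conj decidable_in_ascending X(2) computable_in_const decidable_in_less
          decidable_in_eq b computable_in_proj) (auto simp: k_def)
  next
    fix x x' y :: "nat \<Rightarrow> nat"
    assume eq: "\<And>i. i < k \<Longrightarrow> x i = x' i" and P: "P x (y 0) (y 1) (y 2)"
    have "block G (G (y 1)) (N l E) x = block G (G (y 1)) (N l E) x'"
      by (rule block_cong) (auto simp: eq k_def)
    moreover have "ascending X k (y 2) x'"
      using P by (intro ascending_cong[OF eq]) (simp_all add: P_def)
    ultimately show "P x' (y 0) (y 1) (y 2)"
      using P eq[of 0] eq[of "Suc (size l)"] by (simp add: P_def k_def del: block.simps)
  qed simp
  then have S_dec: "decidable_in H 3 (\<lambda>xs. S (xs ! 0) (xs ! 1) (xs ! 2))"
    by (simp add: S_def)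
  have S_ex: "\<exists>v z. S z v n \<and> z < v" for n
  proof -
    obtain x where x: "ascending X k (max m n) x" "block G g (N l E) x"
      using l unfolding realized_def k_def by fastforce
    have "\<forall>\<^sub>F v in sequentially. block G (G v) (N l E) x \<and> (\<forall>i\<in>{..<k}. x i < v)"
      using eventually_block[of "N l E" x] x(2)
      by (intro eventually_conj eventually_ball_finite) (auto intro: eventually_gt_at_top)
    then obtain v where "block G (G v) (N l E) x" "\<forall>i<k. x i < v"
      by (auto dest!: eventually_happens)
    moreover have "ascending X k n x" "m < x 0"
      using x(1) by (auto simp: ascending_def k_def)
    ultimately have "S (x (Suc (size l))) v n" unfolding S_def P_def by blast
    moreover have "x (Suc (size l)) < v" using \<open>\<forall>i<k. x i < v\<close> by (simp add: k_def)
    ultimately show ?thesis by blast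
  qed
  have S_gt: "n < z" if "S z v n" for z v n
    using that ascendingD(2)[of X k n] by (auto simp: S_def P_def k_def)
  obtain Y where Y: "infinite Y" "decidable_in H 1 (\<lambda>xs. xs ! 0 \<in> Y)"
    and YS: "\<And>z. z \<in> Y \<Longrightarrow> \<exists>v n. S z v n \<and> (\<forall>z'\<in>Y. z < z' \<longrightarrow> v \<le> z')"
    by (rule sparse_decidable_set[of H S, OF S_dec S_ex S_gt]) auto
  obtain y where y: "ascending Y (Suc (size r)) 0 y" "block G g r y"
    using r[OF Y] by (rule realizedE)
  have "y 0 \<in> Y" using ascendingD(1)[OF y(1), of 0] by simp
  from YS[OF this] obtain v n where "S (y 0) v n" and v: "\<And>z'. z' \<in> Y \<Longrightarrow> y 0 < z' \<Longrightarrow> v \<le> z'"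
    by auto
  then obtain x where x: "ascending X k n x" "m < x 0" "block G (G v) (N l E) x"
    "x (Suc (size l)) = y 0"
    by (auto simp only: S_def P_def)
  have "Y \<subseteq> X"
  proof
    fix z assume "z \<in> Y"
    from YS[OF this] obtain v n where "S z v n" by auto
    then obtain x where "ascending X k n x" "x (Suc (size l)) = z"
      by (auto simp only: S_def P_def)
    then show "z \<in> X" using ascendingD(1)[of X k n x "Suc (size l)"] by (simp add: k_def)
  qed
  \<comment> \<open>The tuples are glued along the common entry
    \<open>x (Suc (size l)) = y 0\<close>; hence \<open>y\<close> continues with index 1 at position
    \<open>k\<close>.\<close>
  define w where "w i = (if i < k then x i else y (Suc (i - k)))" for i
  have w_x: "w i = x i" if "i < k" for i using that by (simp add: w_def)
  have w_y: "w (Suc (size l) + i) = y i" for i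
    using x(4) by (cases i) (auto simp: w_def k_def)
  have "ascending X (k + size r) m w"
    unfolding ascending_def
  proof (intro ballI conjI)
    have x_y: "x i < y (Suc j)" if "i < k" "j < size r" for i j
    proof -
      have "x i \<le> y 0"
        using that(1) ascendingD(3)[OF x(1), of i "Suc (size l)"] x(4)
        by (cases "i = Suc (size l)") (auto simp: k_def)
      also have "y 0 < y (Suc j)" using ascendingD(3)[OF y(1), of 0 "Suc j"] that(2) by simp
      finally show ?thesis .
    qed
    fix i assume i: "i \<in> {..<k + size r}"
    show "w i \<in> X"
      using i ascendingD(1)[OF x(1)] ascendingD(1)[OF y(1)] \<open>Y \<subseteq> X\<close> by (auto simp: w_def)
    show w_less: "w j < w i" if "j \<in> {..<i}" for j
      using that i x_y[of j "i - k"] ascendingD(3)[OF x(1), of j i] ascendingD(3)[OF y(1), of "Suc (j - k)" "Suc (i - k)"]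
      by (auto simp: w_def)
    show "m < w i"
      using w_less[of 0] x(2) w_x[of 0] by (cases "i = 0") (auto simp: k_def)
  qed
  moreover have "block G g (N l r) w"
  proof -
    have small: "block G g (N l E) x" using x(3) G_le_g by (rule block_mono)
    have "block G g l (\<lambda>i. w (Suc i)) \<longleftrightarrow> block G g l (\<lambda>i. x (Suc i))"
      by (rule block_cong) (auto simp: w_x k_def)
    moreover have "w 1 < G (w (Suc (Suc (size l)))) (w 0)" if "r \<noteq> E"
    proof -
      have "0 < size r" using that by (cases r) auto
      \<comment> \<open>By the spacing of \<open>Y\<close>, the entry after the overlap is at least
        the certifying stage \<open>v\<close> of \<open>x\<close>, so it reveals the first
        pair.\<close>
      then have "v \<le> y 1" using v ascendingD(1,3)[OF y(1)] by simp
      then have "G v (x 0) \<le> G (w (Suc (Suc (size l)))) (w 0)"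
        using G_mono w_y[of 1] w_x[of 0] by (simp add: k_def)
      then show ?thesis using x(3) w_x[of 1] by (simp add: k_def)
    qed
    ultimately show ?thesis
      using small y(2) w_x[of 0] w_x[of 1] w_x[of "Suc (size l)"] by (simp add: w_y[simplified] k_def)
  qed
  ultimately show "\<exists>x. ascending X (Suc (size (N l r))) m x \<and> block G g (N l r) x"
    by (auto simp: k_def)
qed

text \<open>The induction is over all decidable \<open>X\<close> at once, because the right subtree
  is realized in a thinned set.\<close>

lemma realized:
  assumes "\<not> (\<exists>h. computes H h \<and> dominates h g)"
    and "infinite X" "decidable_in H 1 (\<lambda>xs. xs ! 0 \<in> X)"
  shows "realized X t"
  using assms(2,3)
proof (induction t arbitrary: X)
  case E
  then show ?case by (intro realized_E)
next
  case (N l r)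
  show ?case
    by (rule realized_N[OF assms(1) N.prems realized_N_E[OF assms(1) N.prems N.IH(1)[OF N.prems]] N.IH(2)])
qed

text \<open>No thinning is required between blocks: choosing the rest above the value of
  \<open>g\<close> at the last entry of the first block makes the separating pair large.\<close>

lemma full_realized:
  assumes "\<And>t. realized X t"
  shows "\<exists>x. ascending X (size t) m x \<and> full G g t x"
proof (induction t arbitrary: m)
  case E
  show ?case by (auto simp: ascending_def)
next
  case (N l r)
  define k where "k = Suc (size l)"
  obtain x where x: "ascending X k m x" "block G g l x"
    using assms unfolding realized_def k_def by blast
  obtain y where y: "ascending X (size r) (max (x (size l)) (g (x (size l)))) y" "full G g r y"
    using N.IH(2) by blast
  define w where "w i = (if i < k then x i else y (i - k))" for i
  have x_y: "x i < y j" if "i < k" "j < size r" for i j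
  proof -
    have "x i \<le> x (size l)"
      using that(1) ascendingD(3)[OF x(1), of i "size l"] by (cases "i = size l") (auto simp: k_def)
    then show ?thesis using ascendingD(2)[OF y(1) that(2)] by simp
  qed
  have "ascending X (k + size r) m w"
    unfolding ascending_def
  proof (intro ballI conjI)
    fix i assume i: "i \<in> {..<k + size r}"
    show "w i \<in> X"
      using i ascendingD(1)[OF x(1)] ascendingD(1)[OF y(1)] by (auto simp: w_def)
    show w_less: "w j < w i" if "j \<in> {..<i}" for j
      using that i x_y[of j "i - k"] ascendingD(3)[OF x(1), of j i] ascendingD(3)[OF y(1), of "j - k" "i - k"]
      by (auto simp: w_def)
    have "m < x 0" using ascendingD(2)[OF x(1), of 0] by (simp add: k_def)
    then show "m < w i"
      using w_less[of 0] by (cases "i = 0") (auto simp: w_def k_def)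
  qed
  moreover have "full G g (N l r) w"
  proof -
    have "block G g l w \<longleftrightarrow> block G g l x"
      by (rule block_cong) (auto simp: w_def k_def)
    moreover have "(\<lambda>i. w (Suc (size l) + i)) = y" by (simp add: w_def k_def)
    moreover have "g (w (size l)) \<le> w (Suc (size l))" if "r \<noteq> E"
    proof -
      have "0 < size r" using that by (cases r) auto
      then show ?thesis using ascendingD(2)[OF y(1), of 0] by (simp add: w_def k_def)
    qed
    ultimately show ?thesis using x(2) y(2) by simp
  qed
  ultimately show ?case by (auto simp: k_def)
qed

end

section \<open>The coloring\<close>

lemma catalan_pos: "0 < catalan n"
proof (induction n rule: less_induct)
  case (less n)
  then show ?case by (cases n) (auto intro!: sum_pos)
qed

theorem theorem3p17:
  fixes g :: "nat \<Rightarrow> nat" and n :: nat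
  assumes "left_ce g"
    and "strict_mono g"
    and "n \<ge> 1"
  shows "\<exists>f :: nat set \<Rightarrow> nat.
    f \<in> nsets UNIV n \<rightarrow> {..<catalan n} \<and>
    Delta2_coloring n f \<and>
    (\<forall>H. infinite H \<and> thin n (catalan n) f H \<longrightarrow>
      (\<exists>h. computes H h \<and> dominates h g))"
proof -
  obtain G where G: "computable_in {} 2 (\<lambda>xs. G (xs ! 0) (xs ! 1))"
    "\<And>x. incseq (\<lambda>s. G s x)" "\<And>x. (\<lambda>s. G s x) \<longlonglongrightarrow> g x"
    using assms(1) unfolding left_ce_def by blast
  then interpret left_ce_approximation g G
    using strict_mono_mono[OF assms(2)] by unfold_locales
  define T where "T = {t :: pattern. size t = n}"
  have T: "finite T" "card T = catalan n"
    using finite_card_patterns[of n] by (simp_all add: T_def)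
  then obtain code where code: "bij_betw code T {..<catalan n}"
    using ex_bij_betw_finite_nat[of T] by (auto simp: atLeast0LessThan)
  \<comment> \<open>A tuple without a shape gets the default color 0, so a color always exists. With
    \<open>\<gamma> = G s\<close> the same formula gives the decidable approximation.\<close>
  define shape where "shape \<gamma> xs c \<longleftrightarrow>
    (\<exists>t\<in>T. full G \<gamma> t (\<lambda>i. xs ! i) \<and> code t = c) \<or> (\<forall>t\<in>T. \<not> full G \<gamma> t (\<lambda>i. xs ! i)) \<and> c = 0"
    for \<gamma> xs c
  define f where "f S = (THE c. shape g (sorted_list_of_set S) c)" for S
  have f_set: "f (set xs) = c \<longleftrightarrow> shape g xs c" if "sorted_wrt (<) xs" "length xs = n" for xs c
  proof -
    have "\<exists>!c. shape g xs c"
    proof (rule ex_ex1I)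
      fix c c' assume "shape g xs c" "shape g xs c'"
      moreover have "t = t'" if "t \<in> T" "t' \<in> T" "full G g t (\<lambda>i. xs ! i)" "full G g t' (\<lambda>i. xs ! i)" for t t'
        using that \<open>sorted_wrt (<) xs\<close> \<open>length xs = n\<close>
        by (intro full_unique[where G = G and \<gamma> = g and x = "\<lambda>i. xs ! i"] incseq_G)
          (auto simp: T_def sorted_wrt_iff_nth_less)
      ultimately show "c = c'" unfolding shape_def by metis
    qed (auto simp: shape_def)
    moreover have "sorted_list_of_set (set xs) = xs"
      using that(1) by (simp add: sorted_list_of_set.idem_if_sorted_distinct strict_sorted_iff)
    ultimately show ?thesis unfolding f_def by (metis the1_equality theI')
  qed
  have nsets_list: "\<exists>xs. sorted_wrt (<) xs \<and> length xs = n \<and> set xs = S" if "S \<in> nsets UNIV n" for S :: "nat set"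
    using that by (intro exI[of _ "sorted_list_of_set S"]) (auto simp: nsets_def)
  have range: "f \<in> nsets UNIV n \<rightarrow> {..<catalan n}"
  proof
    fix S :: "nat set" assume "S \<in> nsets UNIV n"
    then obtain xs where "sorted_wrt (<) xs" "length xs = n" "set xs = S" using nsets_list by blast
    then have "shape g xs (f S)" using f_set by blast
    then show "f S \<in> {..<catalan n}"
      using catalan_pos[of n] bij_betwE[OF code] by (auto simp: shape_def)
  qed
  have "Delta2_coloring n f"
    unfolding Delta2_coloring_def
  proof (rule is_Delta_2_limit)
    have full: "decidable_in {} (Suc (Suc n)) (\<lambda>zs. full G (G (zs ! 0)) t (\<lambda>i. zs ! (2 + i)))" if "t \<in> T" for t
      using that by (intro decidable_in_full computable_G) (auto simp: T_def)
    \<comment> \<open>Position 0 holds the stage, position 1 the color, and the tuple starts at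
      position 2.\<close>
    have "decidable_in {} (Suc (Suc n)) (\<lambda>zs. (\<forall>j\<in>{..<n}. \<forall>i\<in>{..<j}. zs ! (2 + i) < zs ! (2 + j)) \<and>
        ((\<exists>t\<in>T. full G (G (zs ! 0)) t (\<lambda>i. zs ! (2 + i)) \<and> code t = zs ! 1) \<or>
        (\<forall>t\<in>T. \<not> full G (G (zs ! 0)) t (\<lambda>i. zs ! (2 + i))) \<and> zs ! 1 = 0))"
      by (intro decidable_in_conj decidable_in_disj decidable_in_finite_all decidable_in_finite_ex
          decidable_in_not decidable_in_less decidable_in_eq computable_in_const computable_in_proj
          full T finite_lessThan) auto
    then show "decidable_in {} (Suc (Suc n)) (\<lambda>zs. sorted_wrt (<) (tl (tl zs)) \<and> shape (G (hd zs)) (tl (tl zs)) (hd (tl zs)))"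
      by (rule computable_in_cong) (auto simp: length_Suc_conv shape_def sorted_wrt_iff_nth_less)
  next
    fix ys :: "nat list" assume "length ys = Suc n"
    then obtain c xs where ys: "ys = c # xs" "length xs = n" by (auto simp: length_Suc_conv)
    have "\<forall>\<^sub>F s in sequentially. \<forall>t\<in>T. full G (G s) t (\<lambda>i. xs ! i) \<longleftrightarrow> full G g t (\<lambda>i. xs ! i)"
      using T(1) eventually_full by (intro eventually_ball_finite) auto
    then show "\<forall>\<^sub>F s in sequentially. (sorted_wrt (<) (tl (tl (s # ys))) \<and>
        shape (G (hd (s # ys))) (tl (tl (s # ys))) (hd (tl (s # ys)))) \<longleftrightarrow>
        (sorted_wrt (<) (tl ys) \<and> f (set (tl ys)) = hd ys)"
    proof eventually_elim
      case (elim s)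
      then have "shape (G s) xs c \<longleftrightarrow> shape g xs c" by (simp add: shape_def)
      then show ?case using f_set ys by auto
    qed
  qed
  moreover have "\<exists>h. computes H h \<and> dominates h g" if H: "infinite H" "thin n (catalan n) f H" for H
  proof (rule ccontr)
    assume no_dom: "\<not> (\<exists>h. computes H h \<and> dominates h g)"
    \<comment> \<open>The induction starts from \<open>H\<close> itself, which is decidable in
      \<open>H\<close> by a single query.\<close>
    have "eval H Oracle xs (of_bool (xs ! 0 \<in> H))" if "length xs = 1" for xs
      using that eval_Oracle[of H "xs ! 0"] by (auto simp: length_Suc_conv)
    then have dec: "decidable_in H 1 (\<lambda>xs. xs ! 0 \<in> H)" unfolding computable_in_def by blast
    have "code t \<in> f ` nsets H n" if "t \<in> T" for t
    proof -
      have size_t: "size t = n" using that by (simp add: T_def)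
      obtain x where x: "ascending H n 0 x" "full G g t x"
        using full_realized[OF realized[OF no_dom H(1) dec], where m = 0 and t = t]
        unfolding size_t by blast
      define xs where "xs = map x [0..<n]"
      have xs: "sorted_wrt (<) xs" "length xs = n"
        using ascendingD(3)[OF x(1)] by (auto simp: xs_def sorted_wrt_iff_nth_less)
      have "full G g t (\<lambda>i. xs ! i) \<longleftrightarrow> full G g t x"
        using that by (intro full_cong) (auto simp: xs_def T_def)
      then have "shape g xs (code t)" using that x(2) by (auto simp: shape_def)
      then have "f (set xs) = code t" using f_set[OF xs] by blast
      moreover have "set xs \<subseteq> H"
        using ascendingD(1)[OF x(1)] by (auto simp: xs_def)
      then have "set xs \<in> nsets H n"
        using xs by (simp add: nsets_def strict_sorted_iff distinct_card)
      ultimately show ?thesis by (metis imageI)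
    qed
    then have "code ` T \<subseteq> f ` nsets H n" by blast
    then have "{..<catalan n} \<subseteq> f ` nsets H n"
      using bij_betw_imp_surj_on[OF code] by simp
    moreover have "f ` nsets H n \<subseteq> {..<catalan n}"
      using range nsets_mono[of H UNIV n] by auto
    ultimately have "f ` nsets H n = {..<catalan n}" by (rule subset_antisym[rotated])
    then have "card (f ` nsets H n) = catalan n" by simp
    \<comment> \<open>Positivity of \<open>catalan n\<close> makes the truncated
      \<open>catalan n - 1\<close> strictly smaller than the number of colors attained.\<close>
    then show False using H(2) catalan_pos[of n] by (simp add: thin_def)
  qed
  ultimately show ?thesis using range by blast
qed

end
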